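(* Let $\mathbb{F}$ be a field of characteristic $0$, let $A\neq 0$ be an abelian group, and let $\partial: A\to\mathbb{F}$ be an additive map with $\partial(x)\ne 0$ for all $x\ne 0$. Then $$\mathrm{Der}(\mathcal{D}_1)_0=\mathrm{ad}(\mathcal{D}_1)_0+\sum_{\mu\in\mathrm{Hom}(A,\mathbb{F})}\mathbb{F}\,\xi_\mu+\sum_{i=1}^{3}\mathbb{F}\,\sigma_i .$$
   Context: Setting: $\mathbb{F}$ is a field of characteristic $0$, $A\ne 0$ is an abelian group, $T=\mathbb{F}\partial$ is a one-dimensional vector space, and $\varphi:T\times A\to\mathbb{F}$ is a pairing, $\mathbb{F}$-linear in the first variable and additive in the second; write $\partial(x)=\varphi(\partial,x)$. The pairing is nondegenerate, i.e. $\partial(x)=0$ implies $x=0$. The Lie algebra $\mathcal{D}_1$ is the $\mathbb{F}$-vector space with basis $\{t^x\partial,\ t^x \mid x\in A\}$ and brackets, for $x,y\in A$, $$[t^x\partial,t^y\partial]=\partial(y-x)\,t^{x+y}\partial,\qquad [t^x\partial,t^y]=\partial(y)\,t^{x+y},\qquad [t^x,t^y]=0.$$ It is $A$-graded with homogeneous components $L_x=\mathbb{F}t^x\partial\oplus\mathbb{F}t^x$. Write $L(x)=t^x\partial$ and $I(x)=t^x$. $\mathrm{Der}(\mathcal{D}_1)_0$ is the space of derivations $D$ of $\mathcal{D}_1$ of degree $0$, i.e. with $D(L_y)\subset L_y$ for all $y\in A$. $\mathrm{ad}(\mathcal{D}_1)_0$ is the space of inner derivations $\mathrm{ad}\,u$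 with $u\in L_0$. $\mathrm{Hom}(A,\mathbb{F})$ is the set of additive maps $A\to\mathbb{F}$. The linear maps $\sigma_1,\sigma_2,\sigma_3,\xi_\mu:\mathcal{D}_1\to\mathcal{D}_1$ ($\mu\in \mathrm{Hom}(A,\mathbb{F})$) are the derivations given, for all $x\in A$, by $$\sigma_1(L(x))=\partial(x)I(x),\ \sigma_1(I(x))=0;\qquad \sigma_2(L(x))=I(x),\ \sigma_2(I(x))=0;$$ $$\sigma_3(L(x))=0,\ \sigma_3(I(x))=I(x);\qquad \xi_\mu(L(x))=\mu(x)L(x),\ \xi_\mu(I(x))=\mu(x)I(x).$$ *)

theory Defs
  imports
    Complex_Main
    "HOL-Library.Poly_Mapping"
    "HOL-Library.Function_Algebras"
    "HOL-Library.Set_Algebras"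
begin

text \<open>\<open>GenL x\<close> and \<open>GenI x\<close> index the basis vectors \<open>t\<^sup>x\<partial>\<close> and \<open>t\<^sup>x\<close>. The group \<open>A\<close> and the field
  are types; an element of the algebra is a finitely supported coefficient function. Below, \<open>d x\<close>
  stands for \<open>\<partial>(x)\<close>.\<close>

datatype 'a gen = GenL 'a | GenI 'a

type_synonym ('a, 'f) D1 = "'a gen \<Rightarrow>\<^sub>0 'f"

definition vscale :: "'f::field \<Rightarrow> ('a, 'f) D1 \<Rightarrow> ('a, 'f) D1" where
  "vscale c u = Poly_Mapping.map ((*) c) u"

definition L :: "'a \<Rightarrow> ('a, 'f::field) D1" where
  "L x = Poly_Mapping.single (GenL x) 1"

definition I :: "'a \<Rightarrow> ('a, 'f::field) D1" where
  "I x = Poly_Mapping.single (GenI x) 1"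

definition lin_ext :: "('a gen \<Rightarrow> ('a, 'f) D1) \<Rightarrow> ('a, 'f::field) D1 \<Rightarrow> ('a, 'f) D1" where
  "lin_ext f u =
     (\<Sum>g\<in>Poly_Mapping.keys u. vscale (Poly_Mapping.lookup u g) (f g))"

lemma lookup_vscale [simp]:
  "Poly_Mapping.lookup (vscale c u) g = c * Poly_Mapping.lookup u g"
  by (simp add: vscale_def Poly_Mapping.map.rep_eq when_def)

global_interpretation D1: vector_space "vscale :: 'f::field \<Rightarrow> ('a, 'f) D1 \<Rightarrow> ('a, 'f) D1"
  by unfold_locales (auto intro!: poly_mapping_eqI simp: lookup_add algebra_simps)

lemma lin_ext_superset:
  assumes "finite S" "Poly_Mapping.keys u \<subseteq> S"
  shows "lin_ext f u = (\<Sum>g\<in>S. vscale (Poly_Mapping.lookup u g) (f g))"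
  unfolding lin_ext_def
  by (rule sum.mono_neutral_left) (use assms in \<open>auto simp: in_keys_iff\<close>)

lemma linear_lin_ext: "Vector_Spaces.linear vscale vscale (lin_ext f)"
proof -
  have add: "lin_ext f (u + v) = lin_ext f u + lin_ext f v" for u v
  proof -
    let ?S = "Poly_Mapping.keys u \<union> Poly_Mapping.keys v"
    show ?thesis
      by (subst (1 2 3) lin_ext_superset[where S = ?S])
        (auto simp: keys_add lookup_add D1.scale_left_distrib sum.distrib
          dest: subsetD[OF keys_add])
  qed
  have scale: "lin_ext f (vscale c u) = vscale c (lin_ext f u)" for c u
    by (subst (1 2) lin_ext_superset[where S = "Poly_Mapping.keys u"])
      (auto simp: in_keys_iff D1.scale_sum_right)
  show ?thesis
    by (simp add: Vector_Spaces.linear_iff D1.vector_space_axioms add scale)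
qed

lemma lin_ext_basis [simp]: "lin_ext f (L x) = f (GenL x)" "lin_ext f (I x) = f (GenI x)"
  by (simp_all add: lin_ext_def L_def I_def)

text \<open>The third equation is \<open>[t\<^sup>x, t\<^sup>y\<partial>] = - [t\<^sup>y\<partial>, t\<^sup>x]\<close>.\<close>

fun basis_bracket ::
  "('a::ab_group_add \<Rightarrow> 'f::field) \<Rightarrow> 'a gen \<Rightarrow> 'a gen \<Rightarrow> ('a, 'f) D1" where
  "basis_bracket d (GenL x) (GenL y) = vscale (d (y - x)) (L (x + y))"
| "basis_bracket d (GenL x) (GenI y) = vscale (d y) (I (x + y))"
| "basis_bracket d (GenI x) (GenL y) = - vscale (d x) (I (x + y))"
| "basis_bracket d (GenI x) (GenI y) = 0"

definition bracket ::
  "('a::ab_group_add \<Rightarrow> 'f::field) \<Rightarrow> ('a, 'f) D1 \<Rightarrow> ('a, 'f) D1 \<Rightarrow> ('a, 'f) D1" where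
  "bracket d u v = lin_ext (\<lambda>g. lin_ext (basis_bracket d g) v) u"

lemma bracket_basis:
  "bracket d (L x) (L y) = vscale (d (y - x)) (L (x + y))"
  "bracket d (L x) (I y) = vscale (d y) (I (x + y))"
  "bracket d (I x) (L y) = - vscale (d x) (I (x + y))"
  "bracket d (I x) (I y) = 0"
  by (simp_all add: bracket_def)

lemma linear_bracket_left: "Vector_Spaces.linear vscale vscale (\<lambda>u. bracket d u v)"
  unfolding bracket_def by (rule linear_lin_ext)

lemma linear_bracket_right:
  fixes d :: "'a::ab_group_add \<Rightarrow> 'f::field"
  shows "Vector_Spaces.linear vscale vscale (bracket d u)"
proof -
  have add: "lin_ext f (v + w) = lin_ext f v + lin_ext f w"
    and scale: "lin_ext f (vscale c v) = vscale c (lin_ext f v)"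
    for f :: "'a gen \<Rightarrow> ('a, 'f) D1" and v w c
    using linear_lin_ext[of f] by (simp_all add: Vector_Spaces.linear_iff)
  have "bracket d u (v + w) = bracket d u v + bracket d u w" for v w
    unfolding bracket_def add
    by (simp add: lin_ext_def[of _ u] D1.scale_right_distrib sum.distrib)
  moreover have "bracket d u (vscale c v) = vscale c (bracket d u v)" for c v
    unfolding bracket_def scale
    by (simp add: lin_ext_def[of _ u] D1.scale_sum_right mult.commute)
  ultimately show ?thesis
    by (simp add: Vector_Spaces.linear_iff D1.vector_space_axioms)
qed

lemma D1_induct [case_names zero add L I]:
  assumes "P 0" "\<And>u v. P u \<Longrightarrow> P v \<Longrightarrow> P (u + v)"
    and "\<And>c x. P (vscale c (L x))" "\<And>c x. P (vscale c (I x))"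
  shows "P u"
proof -
  have u: "u = (\<Sum>g\<in>Poly_Mapping.keys u.
      vscale (Poly_Mapping.lookup u g) (Poly_Mapping.single g 1))"
    by (rule poly_mapping_eqI)
      (simp add: lookup_sum lookup_single when_def in_keys_iff sum.delta if_distrib cong: if_cong)
  have "P (\<Sum>g\<in>S. vscale (k g) (Poly_Mapping.single g 1))" if "finite S" for S k
    using that
  proof (induction S)
    case (insert g S)
    have "P (vscale (k g) (Poly_Mapping.single g 1))"
      using assms(3,4) by (cases g) (auto simp: L_def I_def)
    with insert show ?case by (auto intro: assms(2))
  qed (simp add: assms(1))
  from this[OF finite_keys] show ?thesis by (subst u)
qed

lemma bracket_simps:
  "bracket d (u + u') v = bracket d u v + bracket d u' v"
  "bracket d u (v + v') = bracket d u v + bracket d u v'"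
  "bracket d (vscale c u) v = vscale c (bracket d u v)"
  "bracket d u (vscale c v) = vscale c (bracket d u v)"
  "bracket d 0 v = 0" "bracket d u 0 = 0"
  "bracket d (- u) v = - bracket d u v"
  "bracket d u (- v) = - bracket d u v"
proof -
  have left: "bracket d (u + u') v = bracket d u v + bracket d u' v"
    "bracket d (vscale c u) v = vscale c (bracket d u v)" for u u' v c
    using linear_bracket_left[of d v] by (simp_all add: Vector_Spaces.linear_iff)
  have right: "bracket d u (v + v') = bracket d u v + bracket d u v'"
    "bracket d u (vscale c v) = vscale c (bracket d u v)" for u v v' c
    using linear_bracket_right[of d u] by (simp_all add: Vector_Spaces.linear_iff)
  note all = left right left(2)[of 0] right(2)[of _ 0] left(2)[of "-1"] right(2)[of _ "-1"]
  show "bracket d (u + u') v = bracket d u v + bracket d u' v"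
    "bracket d u (v + v') = bracket d u v + bracket d u v'"
    "bracket d (vscale c u) v = vscale c (bracket d u v)"
    "bracket d u (vscale c v) = vscale c (bracket d u v)"
    "bracket d 0 v = 0" "bracket d u 0 = 0"
    "bracket d (- u) v = - bracket d u v" "bracket d u (- v) = - bracket d u v"
    using all by simp_all
qed

lemma bracket_antisym:
  assumes "additive d"
  shows "bracket d u v = - bracket d v u"
proof -
  note simps = bracket_simps bracket_basis additive.diff[OF assms]
  have L: "bracket d (L x) v = - bracket d v (L x)" for x
    by (induction v rule: D1_induct)
      (simp_all add: simps, auto intro!: poly_mapping_eqI simp: lookup_add algebra_simps)
  have I: "bracket d (I x) v = - bracket d v (I x)" for x
    by (induction v rule: D1_induct)
      (simp_all add: simps, auto intro!: poly_mapping_eqI simp: lookup_add algebra_simps)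
  show ?thesis
    by (induction u rule: D1_induct) (simp_all add: bracket_simps L I)
qed

lemma bracket_jacobi:
  assumes "additive d"
  shows "bracket d u (bracket d v w) = bracket d (bracket d u v) w + bracket d v (bracket d u w)"
proof -
  note simps = bracket_simps bracket_basis additive.diff[OF assms] additive.add[OF assms]
  define J where
    "J u v w = bracket d u (bracket d v w) - bracket d (bracket d u v) w - bracket d v (bracket d u w)"
    for u v w
  have J_lin:
    "J (u + u') v w = J u v w + J u' v w" "J (vscale c u) v w = vscale c (J u v w)"
    "J u (v + v') w = J u v w + J u v' w" "J u (vscale c v) w = vscale c (J u v w)"
    "J u v (w + w') = J u v w + J u v w'" "J u v (vscale c w) = vscale c (J u v w)"
    "J 0 v w = 0" "J u 0 w = 0" "J u v 0 = 0" for u u' v v' w w' c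
    by (simp_all add: J_def bracket_simps D1.scale_right_diff_distrib)
  have basis: "J (L x) (L y) (L z) = 0" "J (L x) (L y) (I z) = 0" "J (L x) (I y) (L z) = 0"
    "J (L x) (I y) (I z) = 0" "J (I x) (L y) (L z) = 0" "J (I x) (L y) (I z) = 0"
    "J (I x) (I y) (L z) = 0" "J (I x) (I y) (I z) = 0" for x y z
    unfolding J_def
    by (rule poly_mapping_eqI; simp only: simps; simp add: lookup_add lookup_minus ac_simps;
        (simp add: algebra_simps)?)+
  have "J (L x) (L y) w = 0" "J (L x) (I y) w = 0" "J (I x) (L y) w = 0" "J (I x) (I y) w = 0"
    for x y
    by (induction w rule: D1_induct) (simp_all add: J_lin basis)
  then have "J (L x) v w = 0" "J (I x) v w = 0" for x
    by (induction v rule: D1_induct) (simp_all add: J_lin)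
  then have "J u v w = 0"
    by (induction u rule: D1_induct) (simp_all add: J_lin)
  then show ?thesis
    by (simp add: J_def algebra_simps)
qed

definition hom_comp :: "'a \<Rightarrow> ('a, 'f::field) D1 set" where
  "hom_comp x = D1.span {L x, I x}"

definition derivation ::
  "('a::ab_group_add \<Rightarrow> 'f::field) \<Rightarrow> (('a, 'f) D1 \<Rightarrow> ('a, 'f) D1) \<Rightarrow> bool" where
  "derivation d D \<longleftrightarrow>
     Vector_Spaces.linear vscale vscale D \<and>
     (\<forall>u v. D (bracket d u v) = bracket d (D u) v + bracket d u (D v))"

definition Der0 :: "('a::ab_group_add \<Rightarrow> 'f::field) \<Rightarrow> (('a, 'f) D1 \<Rightarrow> ('a, 'f) D1) set" where
  "Der0 d = {D. derivation d D \<and> (\<forall>y. D ` hom_comp y \<subseteq> hom_comp y)}"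

definition ad0 :: "('a::ab_group_add \<Rightarrow> 'f::field) \<Rightarrow> (('a, 'f) D1 \<Rightarrow> ('a, 'f) D1) set" where
  "ad0 d = {bracket d u | u. u \<in> hom_comp 0}"

definition sigma1 :: "('a \<Rightarrow> 'f) \<Rightarrow> ('a, 'f::field) D1 \<Rightarrow> ('a, 'f) D1" where
  "sigma1 d = lin_ext (\<lambda>g. case g of GenL x \<Rightarrow> vscale (d x) (I x) | GenI x \<Rightarrow> 0)"

definition sigma2 :: "('a, 'f::field) D1 \<Rightarrow> ('a, 'f) D1" where
  "sigma2 = lin_ext (\<lambda>g. case g of GenL x \<Rightarrow> I x | GenI x \<Rightarrow> 0)"

definition sigma3 :: "('a, 'f::field) D1 \<Rightarrow> ('a, 'f) D1" where
  "sigma3 = lin_ext (\<lambda>g. case g of GenL x \<Rightarrow> 0 | GenI x \<Rightarrow> I x)"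

definition xi :: "('a \<Rightarrow> 'f) \<Rightarrow> ('a, 'f::field) D1 \<Rightarrow> ('a, 'f) D1" where
  "xi \<mu> = lin_ext (\<lambda>g. case g of GenL x \<Rightarrow> vscale (\<mu> x) (L x) | GenI x \<Rightarrow> vscale (\<mu> x) (I x))"

definition opscale ::
  "'f::field \<Rightarrow> (('a, 'f) D1 \<Rightarrow> ('a, 'f) D1) \<Rightarrow> ('a, 'f) D1 \<Rightarrow> ('a, 'f) D1" where
  "opscale c D = (\<lambda>u. vscale c (D u))"

global_interpretation Maps:
  vector_space "opscale :: 'f::field \<Rightarrow> (('a, 'f) D1 \<Rightarrow> ('a, 'f) D1) \<Rightarrow> ('a, 'f) D1 \<Rightarrow> ('a, 'f) D1"
  by unfold_locales
    (auto simp: opscale_def fun_eq_iff D1.scale_right_distrib D1.scale_left_distrib)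

definition line :: "(('a, 'f::field) D1 \<Rightarrow> ('a, 'f) D1) \<Rightarrow> (('a, 'f) D1 \<Rightarrow> ('a, 'f) D1) set" where
  "line D = {opscale c D | c. True}"

text \<open>A sum of infinitely many subspaces consists of finite sums of their elements.\<close>

definition subspace_sum ::
  "(('a, 'f::field) D1 \<Rightarrow> ('a, 'f) D1) set set \<Rightarrow> (('a, 'f) D1 \<Rightarrow> ('a, 'f) D1) set" where
  "subspace_sum \<V> = Maps.span (\<Union>\<V>)"

end

theory Submission
  imports Defs
begin

text \<open>Write a derivation of degree 0 as \<open>D L(x) = a(x) L(x) + b(x) I(x)\<close> and
  \<open>D I(x) = c(x) L(x) + e(x) I(x)\<close>. The brackets \<open>[I(x), I(y)]\<close> and \<open>[L(x), I(y)]\<close> force \<open>c\<close> to be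
  a multiple of \<open>\<partial>\<close> and then to vanish. Associativity of \<open>x + y + z\<close> in \<open>e(x + y) = a(x) + e(y)\<close>
  for \<open>y \<noteq> 0\<close> makes \<open>a\<close> additive, so \<open>e - a\<close> is constant. Finally
  \<open>\<partial>(y - x) b(x + y) = \<partial>(y) b(y) - \<partial>(x) b(x)\<close> has only the solutions \<open>p + q \<partial>\<close>. Hence
  \<open>D = \<xi>\<^sub>a + q \<sigma>\<^sub>1 + p \<sigma>\<^sub>2 + s \<sigma>\<^sub>3\<close>.\<close>

section \<open>Coefficients, homogeneous components and linear maps determined on the basis\<close>

lemma lookup_L [simp]: "Poly_Mapping.lookup (L x) g = (if g = GenL x then 1 else 0)"
  by (auto simp: L_def lookup_single when_def)

lemma lookup_I [simp]: "Poly_Mapping.lookup (I x) g = (if g = GenI x then 1 else 0)"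
  by (auto simp: I_def lookup_single when_def)

lemma mem_hom_comp_iff: "u \<in> hom_comp x \<longleftrightarrow> (\<exists>p q. u = vscale p (L x) + vscale q (I x))"
  by (auto simp: hom_comp_def D1.span_insert D1.span_singleton diff_eq_eq add.commute)

lemma linear_simps:
  assumes "Vector_Spaces.linear vscale vscale D"
  shows "D (u + v) = D u + D v" "D (vscale c u) = vscale c (D u)" "D 0 = 0" "D (- u) = - D u"
proof -
  show add: "D (u + v) = D u + D v" and scale: "D (vscale c u) = vscale c (D u)" for u v c
    using assms by (simp_all add: Vector_Spaces.linear_iff)
  show "D 0 = 0" using scale[of 0] by simp
  show "D (- u) = - D u" using scale[of "- 1"] by simp
qed

lemma linear_eqI:
  assumes D: "Vector_Spaces.linear vscale vscale D" and E: "Vector_Spaces.linear vscale vscale E"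
    and "\<And>x. D (L x) = E (L x)" "\<And>x. D (I x) = E (I x)"
  shows "D = E"
proof
  show "D u = E u" for u
    by (induction u rule: D1_induct) (simp_all add: linear_simps[OF D] linear_simps[OF E] assms)
qed

lemma linear_plus:
  assumes "Vector_Spaces.linear vscale vscale D" "Vector_Spaces.linear vscale vscale E"
  shows "Vector_Spaces.linear vscale vscale (D + E)"
  using assms by (auto simp: Vector_Spaces.linear_iff D1.scale_right_distrib)

lemma linear_opscale:
  assumes "Vector_Spaces.linear vscale vscale D"
  shows "Vector_Spaces.linear vscale vscale (opscale c D)"
  using assms by (auto simp: Vector_Spaces.linear_iff opscale_def D1.scale_right_distrib mult.commute)

section \<open>Membership criteria for degree-0 derivations\<close>

text \<open>Bilinearity carries the Leibniz rule from basis pairs to all pairs. The mixed pair in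
  the order \<open>I x\<close>, \<open>L y\<close> is recovered from \<open>LI\<close> by
  antisymmetry of the bracket.\<close>

lemma derivationI:
  assumes d: "additive d" and D: "Vector_Spaces.linear vscale vscale D"
    and LL: "\<And>x y. D (bracket d (L x) (L y)) = bracket d (D (L x)) (L y) + bracket d (L x) (D (L y))"
    and LI: "\<And>x y. D (bracket d (L x) (I y)) = bracket d (D (L x)) (I y) + bracket d (L x) (D (I y))"
    and II: "\<And>x y. D (bracket d (I x) (I y)) = bracket d (D (I x)) (I y) + bracket d (I x) (D (I y))"
  shows "derivation d D"
proof -
  note lin = linear_simps[OF D] bracket_simps
  have IL: "D (bracket d (I x) (L y)) = bracket d (D (I x)) (L y) + bracket d (I x) (D (L y))" for x y
    using LI[of y x] bracket_antisym[OF d, of "I x"] bracket_antisym[OF d, of "D (I x)"]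
    by (simp add: linear_simps[OF D] algebra_simps)
  have "D (bracket d (L x) v) = bracket d (D (L x)) v + bracket d (L x) (D v)" for x v
    by (induction v rule: D1_induct) (simp_all add: lin LL LI algebra_simps)
  moreover have "D (bracket d (I x) v) = bracket d (D (I x)) v + bracket d (I x) (D v)" for x v
    by (induction v rule: D1_induct) (simp_all add: lin IL II algebra_simps)
  ultimately have "D (bracket d u v) = bracket d (D u) v + bracket d u (D v)" for u v
    by (induction u rule: D1_induct) (simp_all add: lin algebra_simps)
  with D show ?thesis by (simp add: derivation_def)
qed

lemma preserves_hom_compI:
  assumes D: "Vector_Spaces.linear vscale vscale D"
    and "D (L x) \<in> hom_comp x" "D (I x) \<in> hom_comp x"
  shows "D ` hom_comp x \<subseteq> hom_comp x"
proof
  fix w assume "w \<in> D ` hom_comp x"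
  then obtain p q where "w = vscale p (D (L x)) + vscale q (D (I x))"
    by (auto simp: mem_hom_comp_iff linear_simps[OF D])
  then show "w \<in> hom_comp x"
    using assms(2,3) unfolding hom_comp_def by (simp add: D1.span_add D1.span_scale)
qed

text \<open>With no \<open>L\<close> part in \<open>D (I x)\<close>, the Leibniz rule on
  \<open>[L x, L y]\<close> splits into \<open>a\<close> (coefficient of \<open>L (x + y)\<close>)
  and \<open>b\<close> (coefficient of \<open>I (x + y)\<close>), and on \<open>[L x, I y]\<close>
  it becomes \<open>e\<close>. On \<open>[I x, I y]\<close> all terms vanish.\<close>

lemma Der0_memI:
  assumes d: "additive d" and D: "Vector_Spaces.linear vscale vscale D"
    and L: "\<And>x. D (L x) = vscale (a x) (L x) + vscale (b x) (I x)"
    and I: "\<And>x. D (I x) = vscale (e x) (I x)"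
    and a: "\<And>x y. d (y - x) * a (x + y) = d (y - x) * (a x + a y)"
    and b: "\<And>x y. d (y - x) * b (x + y) = d y * b y - d x * b x"
    and e: "\<And>x y. d y * e (x + y) = d y * (a x + e y)"
  shows "D \<in> Der0 d"
proof -
  have "derivation d D"
  proof (rule derivationI[OF d D])
    fix x y
    show "D (bracket d (L x) (L y)) = bracket d (D (L x)) (L y) + bracket d (L x) (D (L y))"
      by (rule poly_mapping_eqI)
        (use a[of y x] b[of y x] in \<open>auto simp: bracket_simps bracket_basis linear_simps[OF D] L I lookup_add
          lookup_minus algebra_simps\<close>)
    show "D (bracket d (L x) (I y)) = bracket d (D (L x)) (I y) + bracket d (L x) (D (I y))"
      by (rule poly_mapping_eqI)
        (use e[of y x] in \<open>auto simp: bracket_simps bracket_basis linear_simps[OF D] L I lookup_add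
          lookup_minus algebra_simps\<close>)
    show "D (bracket d (I x) (I y)) = bracket d (D (I x)) (I y) + bracket d (I x) (D (I y))"
      by (simp add: bracket_simps bracket_basis linear_simps[OF D] I)
  qed
  moreover have "D ` hom_comp y \<subseteq> hom_comp y" for y
    by (rule preserves_hom_compI[OF D])
      (simp_all add: L I hom_comp_def D1.span_add D1.span_scale D1.span_base)
  ultimately show ?thesis by (simp add: Der0_def)
qed

text \<open>Reduces the inclusion of the right-hand sum in \<open>Der0 d\<close> to its
  generators.\<close>

lemma subspace_Der0: "Maps.subspace (Der0 d)"
proof (rule Maps.subspaceI)
  show "0 \<in> Der0 d"
    by (auto simp: Der0_def derivation_def Vector_Spaces.linear_iff bracket_simps D1.vector_space_axioms
        hom_comp_def D1.span_zero)
  show "D + E \<in> Der0 d" if "D \<in> Der0 d" "E \<in> Der0 d" for D E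
    using that linear_plus[of D E]
    by (auto simp: Der0_def derivation_def bracket_simps hom_comp_def image_subset_iff
        D1.span_add)
  show "opscale c D \<in> Der0 d" if "D \<in> Der0 d" for c D
    using that linear_opscale[of D c]
    by (auto simp: Der0_def derivation_def bracket_simps hom_comp_def image_subset_iff opscale_def
        D1.span_scale D1.scale_right_distrib)
qed

text \<open>The Jacobi identity is the Leibniz rule for \<open>bracket d u\<close>; the degree is 0
  because \<open>u\<close> is a combination of \<open>L 0\<close> and \<open>I 0\<close>.\<close>

lemma ad0_subset_Der0:
  assumes "additive d"
  shows "ad0 d \<subseteq> Der0 d"
proof
  fix D assume "D \<in> ad0 d"
  then obtain p q where D: "D = bracket d (vscale p (L 0) + vscale q (I 0))"
    by (auto simp: ad0_def mem_hom_comp_iff)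
  have lin: "Vector_Spaces.linear vscale vscale D"
    unfolding D by (rule linear_bracket_right)
  then have "derivation d D"
    unfolding derivation_def D by (intro conjI allI bracket_jacobi[OF assms])
  moreover have "D ` hom_comp y \<subseteq> hom_comp y" for y
    by (rule preserves_hom_compI[OF lin])
      (simp_all add: D bracket_simps bracket_basis hom_comp_def D1.span_add D1.span_scale
        D1.span_base D1.span_diff D1.span_zero)
  ultimately show "D \<in> Der0 d" by (simp add: Der0_def)
qed

lemma sigma_basis [simp]:
  "sigma1 d (L x) = vscale (d x) (I x)" "sigma1 d (I x) = 0"
  "sigma2 (L x) = I x" "sigma2 (I x) = 0"
  "sigma3 (L x) = 0" "sigma3 (I x) = I x"
  "xi \<mu> (L x) = vscale (\<mu> x) (L x)" "xi \<mu> (I x) = vscale (\<mu> x) (I x)"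
  by (simp_all add: sigma1_def sigma2_def sigma3_def xi_def)

lemma linear_sigma:
  "Vector_Spaces.linear vscale vscale (sigma1 d)" "Vector_Spaces.linear vscale vscale sigma2"
  "Vector_Spaces.linear vscale vscale sigma3" "Vector_Spaces.linear vscale vscale (xi \<mu>)"
  unfolding sigma1_def sigma2_def sigma3_def xi_def by (rule linear_lin_ext)+

lemma sigma_mem_Der0:
  assumes d: "additive d"
  shows "sigma1 d \<in> Der0 d" "sigma2 \<in> Der0 d" "sigma3 \<in> Der0 d" "additive \<mu> \<Longrightarrow> xi \<mu> \<in> Der0 d"
proof -
  note simps = additive.add additive.diff[OF d] algebra_simps
  \<comment> \<open>For \<open>b = d\<close> the equation on \<open>b\<close> is the difference of
    squares \<open>(d y - d x) * (d x + d y)\<close>.\<close>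
  show "sigma1 d \<in> Der0 d"
    by (rule Der0_memI[where a = "\<lambda>_. 0" and b = d and e = "\<lambda>_. 0"])
      (use d in \<open>auto simp: linear_sigma simps\<close>)
  show "sigma2 \<in> Der0 d"
    by (rule Der0_memI[where a = "\<lambda>_. 0" and b = "\<lambda>_. 1" and e = "\<lambda>_. 0"])
      (use d in \<open>auto simp: linear_sigma simps\<close>)
  show "sigma3 \<in> Der0 d"
    by (rule Der0_memI[where a = "\<lambda>_. 0" and b = "\<lambda>_. 0" and e = "\<lambda>_. 1"])
      (use d in \<open>auto simp: linear_sigma simps\<close>)
  show "xi \<mu> \<in> Der0 d" if "additive \<mu>"
    by (rule Der0_memI[where a = \<mu> and b = "\<lambda>_. 0" and e = \<mu>])
      (use d that in \<open>auto simp: linear_sigma simps\<close>)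
qed

section \<open>Functional equations for the coefficients\<close>

text \<open>Evaluating \<open>e (x + y + z)\<close> with the two bracketings gives
  \<open>a (x + y) + e z\<close> and \<open>a x + a y + e z\<close>, so \<open>e z\<close>
  cancels.\<close>

lemma additive_weight:
  fixes a e :: "'a::ab_group_add \<Rightarrow> 'f::field"
  assumes x0: "x0 \<noteq> 0" "x0 + x0 \<noteq> (0::'a)"
    and e: "\<And>x y. y \<noteq> 0 \<Longrightarrow> e (x + y) = a x + e y"
  shows "additive a" "e x = a x + (e x0 - a x0)"
proof -
  have add: "a (x + y) = a x + a y" for x y
  proof -
    \<comment> \<open>Both bracketings need a nonzero second argument. \<open>x0\<close> serves
      unless \<open>y = - x0\<close>, and then \<open>x0 + x0\<close> does.\<close>
    obtain z where z: "z \<noteq> 0" "y + z \<noteq> 0"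
    proof (cases "y + x0 = 0")
      case True
      then have "y + (x0 + x0) \<noteq> 0" using x0 by (metis add.assoc add_0)
      with x0 show ?thesis by (intro that[of "x0 + x0"])
    qed (use x0 that in auto)
    then have "a (x + y) + e z = a x + a y + e z"
      using e[of z "x + y"] e[of "y + z" x] e[of z y] by (simp add: add.assoc)
    then show ?thesis by simp
  qed
  then show "additive a" by (rule additive.intro)
  show "e x = a x + (e x0 - a x0)"
    \<comment> \<open>Splitting \<open>x\<close> as \<open>(x - x0) + x0\<close> keeps the second
      argument nonzero, so \<open>x = 0\<close> is covered as well.\<close>
    using e[OF x0(1), of "x - x0"] add[of "x - x0" x0] by simp
qed

text \<open>Subtract the affine function of \<open>d\<close> that agrees with \<open>b\<close> at
  \<open>0\<close> and \<open>x0\<close>. The difference \<open>g\<close> solves the same equation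
  and vanishes at \<open>0\<close>, \<open>x0\<close> and hence \<open>- x0\<close>. Two relations
  between \<open>g y\<close> and \<open>g (x0 + y)\<close> then force
  \<open>g y = 0\<close>.\<close>

lemma affine_solution:
  fixes d b :: "'a::ab_group_add \<Rightarrow> 'f::field_char_0"
  assumes d: "additive d" "\<And>x. x \<noteq> 0 \<Longrightarrow> d x \<noteq> 0" and x0: "x0 \<noteq> 0"
    and b: "\<And>x y. d (y - x) * b (x + y) = d y * b y - d x * b x"
  shows "b y = b 0 + (b x0 - b 0) / d x0 * d y"
proof -
  note ds = additive.add[OF d(1)] additive.diff[OF d(1)] additive.minus[OF d(1)]
    additive.zero[OF d(1)]
  have d0: "d x0 \<noteq> 0" using d(2) x0 by blast
  define q where "q = (b x0 - b 0) / d x0"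
  define g where "g y = b y - b 0 - q * d y" for y
  have g: "(d y - d x) * g (x + y) = d y * g y - d x * g x" for x y
    using b[of y x] by (simp add: g_def ds algebra_simps)
  have [simp]: "g 0 = 0" "g x0 = 0"
    using d0 by (simp_all add: g_def q_def ds)
  have "d x0 * g (- x0) = 0"
    using g[of "- x0" x0] by (simp add: ds)
  then have [simp]: "g (- x0) = 0" using d0 by simp
  have "(d y - d x0) * g (x0 + y) = d y * g y"
    using g[of y x0] by simp
  moreover have "(d y + 2 * d x0) * g y = (d y + d x0) * g (x0 + y)"
    using g[of "x0 + y" "- x0"] by (simp add: ds algebra_simps)
  \<comment> \<open>Eliminating \<open>g (x0 + y)\<close>: the two quadratic factors of
    \<open>g y\<close> differ only by \<open>2 * (d x0 * d x0)\<close>, which is nonzero in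
    characteristic 0.\<close>
  ultimately have "(d y - d x0) * ((d y + 2 * d x0) * g y) = (d y + d x0) * (d y * g y)"
    by (metis mult.left_commute)
  then have "2 * (d x0 * d x0) * g y = 0" by (simp add: algebra_simps)
  then have "g y = 0" using d0 by simp
  then show ?thesis by (simp add: g_def q_def algebra_simps)
qed

section \<open>Decomposition of a degree-0 derivation and the theorem\<close>

lemma Der0_decompose:
  fixes d :: "'a::ab_group_add \<Rightarrow> 'f::field_char_0"
  assumes d: "additive d" "\<And>x. x \<noteq> 0 \<Longrightarrow> d x \<noteq> 0" and x0: "x0 \<noteq> (0::'a)"
    and D: "D \<in> Der0 d"
  obtains \<mu> q p s where "additive \<mu>"
    "D = xi \<mu> + (opscale q (sigma1 d) + opscale p sigma2 + opscale s sigma3)"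
proof -
  note ds = additive.add[OF d(1)] additive.diff[OF d(1)] additive.zero[OF d(1)]
  have lin: "Vector_Spaces.linear vscale vscale D"
    and leibniz: "D (bracket d u v) = bracket d (D u) v + bracket d u (D v)" for u v
    using D by (auto simp: Der0_def derivation_def)
  have "L x \<in> hom_comp x" "I x \<in> hom_comp x" for x :: 'a
    by (auto simp: hom_comp_def D1.span_base)
  then have "D (L x) \<in> hom_comp x" "D (I x) \<in> hom_comp x" for x
    using D by (auto simp: Der0_def image_subset_iff)
  then obtain a b c e where
    DL: "\<And>x. D (L x) = vscale (a x) (L x) + vscale (b x) (I x)" and
    DI: "\<And>x. D (I x) = vscale (c x) (L x) + vscale (e x) (I x)"
    unfolding mem_hom_comp_iff by metis
  note simps = bracket_simps bracket_basis linear_simps[OF lin] DL DI lookup_add lookup_minus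
  have d0: "d x0 \<noteq> 0" using d(2) x0 by blast
  \<comment> \<open>Its image under \<open>d\<close> is \<open>2 * d x0\<close>, nonzero in
    characteristic 0.\<close>
  have x00: "x0 + x0 \<noteq> 0"
    using d0 ds(1)[of x0 x0] ds(3) by auto

  have c1: "c x * d y = c y * d x" for x y
    using arg_cong[OF leibniz[of "I x" "I y"], of "\<lambda>u. Poly_Mapping.lookup u (GenI (x + y))"]
    by (simp add: simps algebra_simps)
  have c2: "d y * c (x + y) = c y * d (y - x)" for x y
    using arg_cong[OF leibniz[of "L x" "I y"], of "\<lambda>u. Poly_Mapping.lookup u (GenL (x + y))"]
    by (simp add: simps algebra_simps)
  \<comment> \<open>In \<open>c2\<close> with both arguments \<open>x0\<close> the right side
    contains \<open>d 0\<close>. Then \<open>c1\<close> carries the zero from \<open>x0 + x0\<close>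
    to \<open>x0\<close>, and from there to every \<open>x\<close>.\<close>
  have "c (x0 + x0) = 0" using c2[of x0 x0] d0 by (simp add: ds)
  then have "c x0 = 0" using c1[of x0 "x0 + x0"] d(2)[OF x00] by simp
  then have c: "c x = 0" for x using c1[of x x0] d0 by simp

  have "d y * e (x + y) = d y * (a x + e y)" for x y
    using arg_cong[OF leibniz[of "L x" "I y"], of "\<lambda>u. Poly_Mapping.lookup u (GenI (x + y))"]
    by (simp add: simps algebra_simps)
  then have e_add: "e (x + y) = a x + e y" if "y \<noteq> 0" for x y
    using d(2)[OF that] by (metis mult_left_cancel)
  have "additive a" by (rule additive_weight(1)[OF x0 x00 e_add])
  have ex: "e x = a x + (e x0 - a x0)" for x by (rule additive_weight(2)[OF x0 x00 e_add])

  have b: "d (y - x) * b (x + y) = d y * b y - d x * b x" for x y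
    using arg_cong[OF leibniz[of "L x" "L y"], of "\<lambda>u. Poly_Mapping.lookup u (GenI (x + y))"]
    by (simp add: simps algebra_simps)
  have bx: "b x = b 0 + (b x0 - b 0) / d x0 * d x" for x by (rule affine_solution[OF d x0 b])

  \<comment> \<open>\<open>p\<close> and \<open>q\<close> are the intercept and slope of
    \<open>b\<close> as an affine function of \<open>d\<close>; \<open>s\<close> is the constant
    value of \<open>e - a\<close>.\<close>
  define q p s where "q = (b x0 - b 0) / d x0" and "p = b 0" and "s = e x0 - a x0"
  have "D = xi a + (opscale q (sigma1 d) + opscale p sigma2 + opscale s sigma3)"
  proof (rule linear_eqI[OF lin])
    show "Vector_Spaces.linear vscale vscale
        (xi a + (opscale q (sigma1 d) + opscale p sigma2 + opscale s sigma3))"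
      by (intro linear_plus linear_opscale linear_sigma)
    fix x
    have bx: "b x = p + q * d x" and ex: "e x = a x + s"
      unfolding p_def q_def s_def by (rule bx ex)+
    show "D (L x) = (xi a + (opscale q (sigma1 d) + opscale p sigma2 + opscale s sigma3)) (L x)"
      by (rule poly_mapping_eqI) (simp add: DL bx opscale_def lookup_add algebra_simps)
    show "D (I x) = (xi a + (opscale q (sigma1 d) + opscale p sigma2 + opscale s sigma3)) (I x)"
      by (rule poly_mapping_eqI) (simp add: DI c ex opscale_def lookup_add algebra_simps)
  qed
  with \<open>additive a\<close> show thesis by (rule that)
qed

theorem theorem4p5:
  fixes d :: "'a::ab_group_add \<Rightarrow> 'f::field_char_0"
  assumes "\<exists>x::'a. x \<noteq> 0"
    and "additive d"
    and "\<And>x. x \<noteq> 0 \<Longrightarrow> d x \<noteq> 0"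
  shows "Der0 d =
    ad0 d + subspace_sum {line (xi \<mu>) | \<mu>. additive \<mu>} +
    (line (sigma1 d) + line sigma2 + line sigma3)" (is "_ = ?A + ?X + ?S")
proof
  note subspace = subspace_Der0[of d]
  have line: "line D \<subseteq> Der0 d" if "D \<in> Der0 d" for D
    using Maps.subspace_scale[OF subspace that] by (auto simp: line_def)
  have plus: "V + W \<subseteq> Der0 d" if "V \<subseteq> Der0 d" "W \<subseteq> Der0 d" for V W
    using that Maps.subspace_add[OF subspace] by (auto elim!: set_plus_elim)
  \<comment> \<open>The infinite sum is a span of lines, so minimality of the span leaves only each
    \<open>xi \<mu>\<close> to check.\<close>
  have "?X \<subseteq> Der0 d"
    unfolding subspace_sum_def
    by (rule Maps.span_minimal[OF _ subspace])
      (use line sigma_mem_Der0(4)[OF assms(2)] in blast)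
  then show "?A + ?X + ?S \<subseteq> Der0 d"
    using ad0_subset_Der0[OF assms(2)] sigma_mem_Der0[OF assms(2)] by (intro plus line) auto
next
  show "Der0 d \<subseteq> ?A + ?X + ?S"
  proof
    fix D assume "D \<in> Der0 d"
    obtain x0 :: 'a where "x0 \<noteq> 0" using assms(1) by blast
    from Der0_decompose[OF assms(2,3) this \<open>D \<in> Der0 d\<close>] obtain \<mu> q p s where
      \<mu>: "additive \<mu>" and
      D: "D = xi \<mu> + (opscale q (sigma1 d) + opscale p sigma2 + opscale s sigma3)" .
    \<comment> \<open>The inner summand of the decomposition is chosen to be zero, realised as the
      bracket with \<open>0\<close>.\<close>
    have "bracket d 0 \<in> ?A"
      by (auto simp: ad0_def hom_comp_def D1.span_zero)
    moreover have "bracket d 0 = 0"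
      by (simp add: fun_eq_iff bracket_simps)
    ultimately have "0 \<in> ?A" by simp
    moreover have "xi \<mu> \<in> line (xi \<mu>)"
      using Maps.scale_one[of "xi \<mu>"] unfolding line_def by (metis (mono_tags) mem_Collect_eq)
    then have "xi \<mu> \<in> ?X"
      unfolding subspace_sum_def by (intro Maps.span_base) (use \<mu> in blast)
    ultimately have "0 + xi \<mu> \<in> ?A + ?X" by (rule set_plus_intro)
    moreover have "opscale q (sigma1 d) + opscale p sigma2 + opscale s sigma3 \<in> ?S"
      by (intro set_plus_intro) (auto simp: line_def)
    ultimately show "D \<in> ?A + ?X + ?S"
      unfolding D by (simp only: add_0 set_plus_intro)
  qed
qed

end
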